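(* Let $X$ be a locally compact Hausdorff space and $Y$ a Banach space. Then the map $\varphi$ from $(MU(X,Y),\tau_{UC})$ onto $(MC(X,Y),\tau_{UC})$, defined by $\varphi(F)(x)=\overline{co}\,F(x)$ for all $x\in X$, is a homeomorphism.
   Context: A set-valued map $F$ from $X$ to $Y$ assigns to each $x\in X$ a subset $F(x)\subset Y$. Write $G\subset F$ if $G(x)\subset F(x)$ for all $x\in X$. $F$ is upper semicontinuous if for every $x\in X$ and every open $V\supset F(x)$ there is an open neighborhood $U$ of $x$ with $F(u)\subset V$ for all $u\in U$. $F$ is usco if it is upper semicontinuous and all its values are nonempty and compact; $F$ is cusco if it is usco and all its values are convex. $F$ is minimal usco (minimal cusco) if it is usco (cusco) and does not properly contain any other usco (cusco) map from $X$ to $Y$. $MU(X,Y)$ and $MC(X,Y)$ denote the sets of all minimal usco and all minimal cusco maps from $X$ to $Y$, respectively. $\overline{co}\,B$ denotes the closed convex hull of $B$. $Y$ carries the metric $d$ induced by its norm. For nonempty closed $A,B\subset Y$, let $e_d(A,B)=\sup\{d(a,B):a\in A\}$, where $d(a,B)=\inf_{b\in B}d(a,b)$, and let $H_d(A,B)=\max\{e_d(A,B),e_d(B,A)\}$ (the extended-valued Hausdorff metric). Let $F(X,Y)$ be the set of all set-valued maps from $X$ to $Y$ with nonempty closed values. The topology $\tau_{UC}$ of uniform convergence on compact sets on $F(X,Y)$ is induced by the uniformity with base $\{(\Phi,\Psi): H_d(\Phi(x),\Psi(x))<\varepsilon\ \forall x\in K\}$, with $K\subset X$ nonempty compact and $\varepsilon>0$.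 $MU(X,Y)$ and $MC(X,Y)$ carry the corresponding subspace topologies. *)

theory Defs
  imports "HOL-Analysis.Analysis"
begin

text \<open>A set-valued map from \<open>X\<close> to \<open>Y\<close> is a function of type \<open>'a \<Rightarrow> 'b set\<close>;
  the space \<open>X\<close> is the whole type \<open>'a\<close>.\<close>

definition usc :: "('a::topological_space \<Rightarrow> 'b::topological_space set) \<Rightarrow> bool" where
  "usc F \<longleftrightarrow>
    (\<forall>x V. open V \<and> F x \<subseteq> V \<longrightarrow> (\<exists>U. open U \<and> x \<in> U \<and> (\<forall>u\<in>U. F u \<subseteq> V)))"

definition usco :: "('a::topological_space \<Rightarrow> 'b::topological_space set) \<Rightarrow> bool" where
  "usco F \<longleftrightarrow> usc F \<and> (\<forall>x. F x \<noteq> {} \<and> compact (F x))"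

definition cusco :: "('a::topological_space \<Rightarrow> 'b::real_normed_vector set) \<Rightarrow> bool" where
  "cusco F \<longleftrightarrow> usco F \<and> (\<forall>x. convex (F x))"

definition minimal_usco :: "('a::topological_space \<Rightarrow> 'b::topological_space set) \<Rightarrow> bool" where
  "minimal_usco F \<longleftrightarrow> usco F \<and> (\<forall>G. usco G \<and> (\<forall>x. G x \<subseteq> F x) \<longrightarrow> G = F)"

definition minimal_cusco :: "('a::topological_space \<Rightarrow> 'b::real_normed_vector set) \<Rightarrow> bool" where
  "minimal_cusco F \<longleftrightarrow> cusco F \<and> (\<forall>G. cusco G \<and> (\<forall>x. G x \<subseteq> F x) \<longrightarrow> G = F)"

definition MU :: "('a::topological_space \<Rightarrow> 'b::topological_space set) set" where
  "MU = {F. minimal_usco F}"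

definition MC :: "('a::topological_space \<Rightarrow> 'b::real_normed_vector set) set" where
  "MC = {F. minimal_cusco F}"

text \<open>Excess and Hausdorff distance are extended-valued, so that unbounded sets may be at
  distance \<open>\<infinity>\<close>; they are meant for nonempty closed arguments only.\<close>

definition excess :: "'b::metric_space set \<Rightarrow> 'b set \<Rightarrow> ereal" where
  "excess A B = (SUP a\<in>A. ereal (infdist a B))"

definition Hausdorff_dist :: "'b::metric_space set \<Rightarrow> 'b set \<Rightarrow> ereal" where
  "Hausdorff_dist A B = max (excess A B) (excess B A)"

definition closed_maps :: "('a \<Rightarrow> 'b::topological_space set) set" where
  "closed_maps = {F. \<forall>x. F x \<noteq> {} \<and> closed (F x)}"

definition UC_entourage ::
    "'a set \<Rightarrow> real \<Rightarrow> (('a \<Rightarrow> 'b::metric_space set) \<times> ('a \<Rightarrow> 'b set)) set" where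
  "UC_entourage K \<epsilon> = {(\<Phi>, \<Psi>). \<Phi> \<in> closed_maps \<and> \<Psi> \<in> closed_maps \<and>
      (\<forall>x\<in>K. Hausdorff_dist (\<Phi> x) (\<Psi> x) < ereal \<epsilon>)}"

text \<open>The topology induced by the uniformity with base the sets \<open>UC_entourage K \<epsilon>\<close>:
  \<open>W\<close> is open iff it contains, with each \<open>\<Phi>\<close>, the section at \<open>\<Phi>\<close> of some basic entourage.\<close>

definition UC_open :: "('a::topological_space \<Rightarrow> 'b::metric_space set) set \<Rightarrow> bool" where
  "UC_open W \<longleftrightarrow> W \<subseteq> closed_maps \<and>
    (\<forall>\<Phi>\<in>W. \<exists>K \<epsilon>. compact K \<and> K \<noteq> {} \<and> \<epsilon> > 0 \<and> UC_entourage K \<epsilon> `` {\<Phi>} \<subseteq> W)"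

definition UC_topology :: "('a::topological_space \<Rightarrow> 'b::metric_space set) topology" where
  "UC_topology = topology UC_open"

lemma istopology_UC_open: "istopology UC_open"
  unfolding istopology_def
proof (intro conjI allI impI)
  fix S T :: "('a \<Rightarrow> 'b set) set"
  assume S: "UC_open S" and T: "UC_open T"
  show "UC_open (S \<inter> T)"
    unfolding UC_open_def
  proof (intro conjI ballI)
    show "S \<inter> T \<subseteq> closed_maps"
      using S by (auto simp: UC_open_def)
  next
    fix \<Phi> assume "\<Phi> \<in> S \<inter> T"
    then obtain K1 e1 K2 e2 where
      1: "compact K1" "K1 \<noteq> {}" "e1 > 0" "UC_entourage K1 e1 `` {\<Phi>} \<subseteq> S" and
      2: "compact K2" "K2 \<noteq> {}" "e2 > 0" "UC_entourage K2 e2 `` {\<Phi>} \<subseteq> T"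
      using S T unfolding UC_open_def by (meson IntD1 IntD2)
    have "UC_entourage (K1 \<union> K2) (min e1 e2) `` {\<Phi>}
        \<subseteq> UC_entourage K1 e1 `` {\<Phi>} \<inter> UC_entourage K2 e2 `` {\<Phi>}"
      by (auto simp: UC_entourage_def intro: order.strict_trans2[of _ "ereal (min e1 e2)"])
    then show "\<exists>K \<epsilon>. compact K \<and> K \<noteq> {} \<and> \<epsilon> > 0 \<and> UC_entourage K \<epsilon> `` {\<Phi>} \<subseteq> S \<inter> T"
      using 1 2 by (intro exI[of _ "K1 \<union> K2"] exI[of _ "min e1 e2"]) auto
  qed
next
  fix \<K> :: "('a \<Rightarrow> 'b set) set set"
  assume *: "\<forall>W\<in>\<K>. UC_open W"
  show "UC_open (\<Union>\<K>)"
    unfolding UC_open_def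
  proof (intro conjI ballI)
    show "\<Union>\<K> \<subseteq> closed_maps"
      using * by (auto simp: UC_open_def)
  next
    fix \<Phi> assume "\<Phi> \<in> \<Union>\<K>"
    then obtain W where W: "W \<in> \<K>" "\<Phi> \<in> W"
      by blast
    then obtain K e where "compact K" "K \<noteq> {}" "e > 0" "UC_entourage K e `` {\<Phi>} \<subseteq> W"
      using * unfolding UC_open_def by meson
    moreover have "W \<subseteq> \<Union>\<K>"
      using W by blast
    ultimately show "\<exists>K \<epsilon>. compact K \<and> K \<noteq> {} \<and> \<epsilon> > 0 \<and> UC_entourage K \<epsilon> `` {\<Phi>} \<subseteq> \<Union>\<K>"
      by (meson order_trans)
  qed
qed

lemma openin_UC_topology: "openin UC_topology = UC_open"
  unfolding UC_topology_def by (rule topology_inverse'[OF istopology_UC_open])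

lemma topspace_UC_topology: "topspace UC_topology = closed_maps"
proof -
  have "compact {undefined}" "{undefined} \<noteq> {}" "(1::real) > 0"
    by auto
  moreover have "UC_entourage K e `` {\<Phi>} \<subseteq> closed_maps" for K e and \<Phi> :: "'a \<Rightarrow> 'b set"
    by (auto simp: UC_entourage_def)
  ultimately have "UC_open (closed_maps :: ('a \<Rightarrow> 'b set) set)"
    unfolding UC_open_def by (metis order_refl)
  then show ?thesis
    unfolding topspace_def openin_UC_topology by (auto simp: UC_open_def)
qed

definition co_map :: "('a \<Rightarrow> 'b::real_normed_vector set) \<Rightarrow> 'a \<Rightarrow> 'b set" where
  "co_map F = (\<lambda>x. closure (convex hull (F x)))"

end

theory Submission
  imports Defs
begin

text \<open>If \<open>F\<close> is minimal usco and \<open>F x\<close> meets an open set \<open>V\<close>, then arbitrarily close to \<open>x\<close> there is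
  a point \<open>u\<close> with \<open>F u \<subseteq> V\<close>: otherwise removing \<open>V\<close> from the values of \<open>F\<close> near \<open>x\<close> would give a
  smaller usco map. Taking for \<open>V\<close> a small ball, which also controls the closed convex hull of \<open>F u\<close>,
  one sees that \<open>co_map F\<close> is minimal cusco and that a bound on the Hausdorff distance of \<open>co_map F\<close>
  and \<open>co_map G\<close> throughout an open set carries over to \<open>F\<close> and \<open>G\<close> on that set. Hence \<open>co_map\<close> is
  injective, and, as every compact set has a compact neighbourhood, its inverse is continuous.
  Continuity of \<open>co_map\<close> holds because closed convex hulls do not increase Hausdorff distances, and
  surjectivity because every usco map contains a minimal one by Zorn's lemma.\<close>

section \<open>Distances to sets and closed convex hulls\<close>

lemma infdist_lessE:
  assumes "infdist y A < r" "A \<noteq> {}"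
  obtains a where "a \<in> A" "dist y a < r"
  using assms by (auto simp: infdist_notempty cINF_less_iff)

lemma le_infdistI:
  assumes "A \<noteq> {}" "\<And>a. a \<in> A \<Longrightarrow> r \<le> dist y a"
  shows "r \<le> infdist y A"
  using assms by (auto simp: infdist_notempty intro: cINF_greatest)

lemma closed_infdist_le: "closed {y. infdist y A \<le> r}"
  by (intro closed_Collect_le continuous_intros)

lemma open_infdist_less: "open {y. infdist y A < r}"
  by (intro open_Collect_less continuous_intros)

text \<open>Nearest points need not exist, so convex combinations of points of \<open>C\<close> that
  are nearest up to \<open>e\<close> are used. This convexity is what lets distance bounds pass from
  a set to its closed convex hull.\<close>

lemma convex_infdist_le:
  fixes C :: "'b::real_normed_vector set"
  assumes "convex C"
  shows "convex {y. infdist y C \<le> r}"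
proof (cases "C = {}")
  case True
  \<comment> \<open>The distance to the empty set is 0 by convention, so the sublevel set is the
    whole space or empty.\<close>
  then show ?thesis
    by (cases "0 \<le> r") (auto simp: infdist_def)
next
  case False
  show ?thesis
  proof (rule convexI)
    fix x y and u v :: real
    assume x: "x \<in> {y. infdist y C \<le> r}" and y: "y \<in> {y. infdist y C \<le> r}"
      and uv: "0 \<le> u" "0 \<le> v" "u + v = 1"
    have "infdist (u *\<^sub>R x + v *\<^sub>R y) C \<le> r + e" if "e > 0" for e
    proof -
      have "infdist x C < r + e" "infdist y C < r + e"
        using x y \<open>e > 0\<close> by auto
      then obtain a b where a: "a \<in> C" "dist x a < r + e" and b: "b \<in> C" "dist y b < r + e"
        using False by (metis infdist_lessE)
      have "dist (u *\<^sub>R x + v *\<^sub>R y) (u *\<^sub>R a + v *\<^sub>R b) = norm (u *\<^sub>R (x - a) + v *\<^sub>R (y - b))"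
        by (simp add: dist_norm algebra_simps)
      also have "\<dots> \<le> u * dist x a + v * dist y b"
        using uv by (intro norm_triangle_le) (simp add: dist_norm)
      also have "\<dots> \<le> u * (r + e) + v * (r + e)"
        using a b uv by (intro add_mono mult_left_mono) auto
      also have "\<dots> = r + e"
        using uv by (simp flip: distrib_right)
      finally show ?thesis
        using convexD[OF assms a(1) b(1) uv] by (rule infdist_le2[rotated])
    qed
    then show "u *\<^sub>R x + v *\<^sub>R y \<in> {y. infdist y C \<le> r}"
      by (auto intro: field_le_epsilon)
  qed
qed

lemma closure_convex_hull_minimal:
  assumes "S \<subseteq> T" "convex T" "closed T"
  shows "closure (convex hull S) \<subseteq> T"
  using assms by (intro closure_minimal hull_minimal)

lemma subset_closure_convex_hull: "S \<subseteq> closure (convex hull S)"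
  by (meson closure_subset hull_subset order_trans)

text \<open>The convex hull of \<open>S\<close> lies within \<open>e\<close> of the compact convex hull of a finite \<open>e\<close>-net of \<open>S\<close>,
  so it is totally bounded.\<close>

lemma compact_closure_convex_hull:
  fixes S :: "'b::banach set"
  assumes "compact S"
  shows "compact (closure (convex hull S))"
  unfolding compact_eq_totally_bounded
proof (intro conjI allI impI)
  show "complete (closure (convex hull S))"
    by (simp add: complete_eq_closed)
  fix e :: real assume "e > 0"
  show "\<exists>k. finite k \<and> closure (convex hull S) \<subseteq> (\<Union>x\<in>k. ball x e)"
  proof (cases "S = {}")
    case True
    then show ?thesis by auto
  next
    case False
    \<comment> \<open>The non-strict bound \<open>e / 4\<close> survives the passage to the closed
      hull and is strictly below \<open>e / 2\<close>. So a point of \<open>convex hull k\<close>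
      lies within \<open>e / 2\<close>, and a point of its net \<open>m\<close> within another
      \<open>e / 2\<close>.\<close>
    have "e / 4 > 0"
      using \<open>e > 0\<close> by simp
    then obtain k where k: "finite k" "S \<subseteq> (\<Union>x\<in>k. ball x (e / 4))"
      using assms unfolding compact_eq_totally_bounded by meson
    have "k \<noteq> {}"
      using k False by auto
    have "compact (convex hull k)"
      using k(1) by (rule finite_imp_compact_convex_hull)
    then obtain m where m: "finite m" "convex hull k \<subseteq> (\<Union>x\<in>m. ball x (e / 2))"
      using \<open>e > 0\<close> unfolding compact_eq_totally_bounded by (meson half_gt_zero)
    have "S \<subseteq> {y. infdist y (convex hull k) \<le> e / 4}"
    proof
      fix y assume "y \<in> S"
      then obtain x where "x \<in> k" "dist y x < e / 4"
        using k(2) by (auto simp: dist_commute)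
      then show "y \<in> {y. infdist y (convex hull k) \<le> e / 4}"
        using infdist_le2[of x "convex hull k" y "e / 4"] by (simp add: hull_inc)
    qed
    then have sub: "closure (convex hull S) \<subseteq> {y. infdist y (convex hull k) \<le> e / 4}"
      by (intro closure_convex_hull_minimal convex_infdist_le closed_infdist_le convex_convex_hull)
    have "closure (convex hull S) \<subseteq> (\<Union>x\<in>m. ball x e)"
    proof
      fix y assume "y \<in> closure (convex hull S)"
      then have "infdist y (convex hull k) < e / 2"
        using sub \<open>e > 0\<close> by (force simp: subset_iff)
      then obtain c where c: "c \<in> convex hull k" "dist y c < e / 2"
        using \<open>k \<noteq> {}\<close> by (metis convex_hull_eq_empty infdist_lessE)
      then obtain x where "x \<in> m" "dist x c < e / 2"
        using m(2) by auto
      then have "dist x y < e"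
        using c(2) by (metis dist_commute dist_triangle_half_l)
      then show "y \<in> (\<Union>x\<in>m. ball x e)"
        using \<open>x \<in> m\<close> by auto
    qed
    then show ?thesis
      using m(1) by blast
  qed
qed

text \<open>Compactness makes one radius serve for all points of \<open>A\<close>. Upper
  semicontinuity can then be checked on sublevel sets of the distance instead of arbitrary open
  sets.\<close>

lemma compact_subset_open_infdist:
  fixes A :: "'b::metric_space set"
  assumes "compact A" "A \<noteq> {}" "open V" "A \<subseteq> V"
  obtains e where "e > 0" "{y. infdist y A < e} \<subseteq> V"
proof -
  obtain e where e: "e > 0" "(\<Union>x\<in>A. ball x e) \<subseteq> V"
    using assms by (metis compact_subset_open_imp_ball_epsilon_subset)
  have "{y. infdist y A < e} \<subseteq> V"
  proof
    fix y assume "y \<in> {y. infdist y A < e}"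
    then obtain a where "a \<in> A" "dist y a < e"
      using \<open>A \<noteq> {}\<close> by (auto elim: infdist_lessE)
    then have "y \<in> (\<Union>x\<in>A. ball x e)"
      by (auto simp: dist_commute)
    then show "y \<in> V"
      using e(2) by blast
  qed
  then show thesis
    using e(1) that by blast
qed

section \<open>The excess and the Hausdorff distance\<close>

lemma excess_le_iff: "excess A B \<le> ereal r \<longleftrightarrow> (\<forall>a\<in>A. infdist a B \<le> r)"
  by (simp add: excess_def SUP_le_iff)

lemma infdist_triangle_excess:
  assumes "infdist a B \<le> r" "excess B C \<le> ereal s" "B \<noteq> {}"
  shows "infdist a C \<le> r + s"
proof (rule field_le_epsilon)
  fix e :: real assume "e > 0"
  then have "infdist a B < r + e"
    using assms(1) by simp
  then obtain b where b: "b \<in> B" "dist a b < r + e"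
    using assms(3) by (rule infdist_lessE)
  have "infdist a C \<le> infdist b C + dist a b"
    by (rule infdist_triangle)
  also have "infdist b C \<le> s"
    using assms(2) b(1) by (simp add: excess_le_iff)
  finally show "infdist a C \<le> r + s + e"
    using b(2) by simp
qed

lemma excess_triangle:
  assumes "excess A B \<le> ereal r" "excess B C \<le> ereal s" "B \<noteq> {}"
  shows "excess A C \<le> ereal (r + s)"
  using assms unfolding excess_le_iff[of A] by (blast intro: infdist_triangle_excess)

lemma Hausdorff_dist_le_iff:
  "Hausdorff_dist A B \<le> r \<longleftrightarrow> excess A B \<le> r \<and> excess B A \<le> r"
  by (simp add: Hausdorff_dist_def)

lemma Hausdorff_dist_triangle:
  assumes "Hausdorff_dist A B \<le> ereal r" "Hausdorff_dist B C \<le> ereal s" "B \<noteq> {}"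
  shows "Hausdorff_dist A C \<le> ereal (r + s)"
  using assms excess_triangle[of A B r C s] excess_triangle[of C B s A r]
  by (simp add: Hausdorff_dist_le_iff add.commute)

lemma Hausdorff_dist_self: "Hausdorff_dist A A \<le> 0"
  using excess_le_iff[of A A 0] by (simp add: Hausdorff_dist_le_iff zero_ereal_def)

text \<open>The points within \<open>r\<close> of the closed convex hull of \<open>B\<close> form a
  closed convex set containing \<open>A\<close>, hence also the closed convex hull of
  \<open>A\<close>.\<close>

lemma excess_closure_convex_hull:
  fixes A B :: "'b::real_normed_vector set"
  assumes "excess A B \<le> ereal r" "B \<noteq> {}"
  shows "excess (closure (convex hull A)) (closure (convex hull B)) \<le> ereal r"
proof -
  let ?C = "closure (convex hull B)"
  have "infdist a ?C \<le> r" if "a \<in> A" for a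
    using that assms infdist_mono[OF subset_closure_convex_hull assms(2), of a]
    by (force simp: excess_le_iff)
  then have "closure (convex hull A) \<subseteq> {y. infdist y ?C \<le> r}"
    by (intro closure_convex_hull_minimal convex_infdist_le closed_infdist_le) auto
  then show ?thesis
    by (auto simp: excess_le_iff)
qed

lemma Hausdorff_dist_co_map_le:
  assumes "Hausdorff_dist (F x) (G x) \<le> ereal r" "F x \<noteq> {}" "G x \<noteq> {}"
  shows "Hausdorff_dist (co_map F x) (co_map G x) \<le> ereal r"
  using assms by (simp add: Hausdorff_dist_le_iff co_map_def excess_closure_convex_hull)

section \<open>Minimal usco and minimal cusco maps\<close>

lemma uscD:
  assumes "usc F" "open V" "F x \<subseteq> V"
  obtains U where "open U" "x \<in> U" "\<And>u. u \<in> U \<Longrightarrow> F u \<subseteq> V"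
  using assms unfolding usc_def by meson

lemma minimal_usco_meets_open:
  assumes F: "minimal_usco F" and "open U" "x \<in> U" "open V" "F x \<inter> V \<noteq> {}"
  obtains u where "u \<in> U" "F u \<subseteq> V"
proof (rule ccontr)
  assume "\<not> thesis"
  with that have nsub: "\<not> F u \<subseteq> V" if "u \<in> U" for u
    using that by blast
  \<comment> \<open>By \<open>nsub\<close> the values stay nonempty. At points of \<open>U\<close>,
    semicontinuity is tested with \<open>W \<union> V\<close> for \<open>F\<close> on a
    neighbourhood inside \<open>U\<close>; elsewhere nothing was removed at the point itself, and
    \<open>G\<close> lies below \<open>F\<close> nearby.\<close>
  define G where "G u = (if u \<in> U then F u - V else F u)" for u
  have usco: "usco F"
    using F by (simp add: minimal_usco_def)
  have "usc G"
    unfolding usc_def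
  proof (intro allI impI)
    fix z W assume W: "open W \<and> G z \<subseteq> W"
    show "\<exists>N. open N \<and> z \<in> N \<and> (\<forall>u\<in>N. G u \<subseteq> W)"
    proof (cases "z \<in> U")
      case True
      then have "F z \<subseteq> W \<union> V"
        using W by (auto simp: G_def)
      then obtain N where N: "open N" "z \<in> N" "\<And>u. u \<in> N \<Longrightarrow> F u \<subseteq> W \<union> V"
        using usco W \<open>open V\<close> by (metis open_Un uscD usco_def)
      then have "\<forall>u\<in>N \<inter> U. G u \<subseteq> W"
        by (auto simp: G_def subset_iff)
      then show ?thesis
        using N True \<open>open U\<close> by (metis IntI open_Int)
    next
      case False
      then have "F z \<subseteq> W"
        using W by (auto simp: G_def)
      then obtain N where N: "open N" "z \<in> N" "\<And>u. u \<in> N \<Longrightarrow> F u \<subseteq> W"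
        using usco W by (metis uscD usco_def)
      then have "\<forall>u\<in>N. G u \<subseteq> W"
        by (auto simp: G_def subset_iff)
      then show ?thesis
        using N by blast
    qed
  qed
  moreover have "G u \<noteq> {} \<and> compact (G u)" for u
    using nsub usco \<open>open V\<close> by (auto simp: G_def usco_def intro: compact_diff)
  ultimately have "G = F"
    using F by (auto simp: minimal_usco_def usco_def G_def)
  then have "F x - V = F x"
    using \<open>x \<in> U\<close> by (metis G_def)
  then show False
    using assms(5) by blast
qed

section \<open>Existence of minimal usco maps\<close>

lemma usco_INF_chain:
  fixes C :: "('a::topological_space \<Rightarrow> 'b::t2_space set) set"
  assumes ne: "C \<noteq> {}" and usco: "\<And>F. F \<in> C \<Longrightarrow> usco F"
    and chain: "\<And>F G. F \<in> C \<Longrightarrow> G \<in> C \<Longrightarrow> F \<le> G \<or> G \<le> F"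
  shows "usco (\<lambda>x. \<Inter>F\<in>C. F x)"
proof -
  have compact: "compact (F x)" if "F \<in> C" for F x
    using usco[OF that] by (simp add: usco_def)
  \<comment> \<open>A single member of the chain already fits into \<open>V\<close>, so
    semicontinuity is inherited from it. The complements of the values cover the compact set
    \<open>F0 x - V\<close>, so finitely many suffice.\<close>
  have member: "\<exists>F\<in>C. F x \<subseteq> V" if V: "open V" "(\<Inter>F\<in>C. F x) \<subseteq> V" for x V
  proof -
    obtain F0 where F0: "F0 \<in> C"
      using ne by blast
    have "compact (F0 x - V)"
      using F0 V(1) by (intro compact_diff compact)
    moreover have "F0 x - V \<subseteq> (\<Union>F\<in>C. - F x)"
      using V by auto
    moreover have "open (- F x)" if "F \<in> C" for F
      using compact[OF that] by (simp add: compact_imp_closed open_Compl)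
    ultimately obtain D where D: "D \<subseteq> C" "finite D" "F0 x - V \<subseteq> (\<Union>F\<in>D. - F x)"
      by (metis compactE_image)
    \<comment> \<open>In a chain a minimal element of a finite subfamily is least. Including
      \<open>F0\<close> ensures that \<open>M x - V\<close> lies in the covered set, while
      \<open>M x\<close> misses every complement of the cover.\<close>
    obtain M where M: "M \<in> insert F0 D" "\<And>F. F \<in> insert F0 D \<Longrightarrow> F \<le> M \<Longrightarrow> M = F"
      using finite_has_minimal[of "insert F0 D"] D(2) by auto
    have "M \<le> F" if "F \<in> insert F0 D" for F
      using chain[of M F] M that D(1) F0 by blast
    then have "M x \<subseteq> F x" if "F \<in> insert F0 D" for F
      using that by (meson le_funD)
    then have "M x \<subseteq> V"
      using D(3) by blast
    then show ?thesis
      using M(1) D(1) F0 by blast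
  qed
  show ?thesis
    unfolding usco_def usc_def
  proof (intro conjI allI impI)
    fix x V assume "open V \<and> (\<Inter>F\<in>C. F x) \<subseteq> V"
    then obtain F where F: "F \<in> C" "F x \<subseteq> V"
      using member by blast
    then obtain U where "open U" "x \<in> U" "\<And>u. u \<in> U \<Longrightarrow> F u \<subseteq> V"
      using usco \<open>open V \<and> _\<close> by (metis uscD usco_def)
    with F(1) show "\<exists>U. open U \<and> x \<in> U \<and> (\<forall>u\<in>U. (\<Inter>F\<in>C. F u) \<subseteq> V)"
      by (meson INF_lower2)
  next
    fix x
    show "(\<Inter>F\<in>C. F x) \<noteq> {}"
      \<comment> \<open>With \<open>V\<close> empty, an empty intersection would force some value
        \<open>F x\<close> to be empty.\<close>
      using member[of "{}" x] usco by (auto simp: usco_def)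
    obtain F where F: "F \<in> C"
      using ne by blast
    have "closed (\<Inter>F\<in>C. F x)"
      using compact by (auto intro: compact_imp_closed)
    then have "compact (F x \<inter> (\<Inter>F\<in>C. F x))"
      using compact[OF F] by blast
    also have "F x \<inter> (\<Inter>F\<in>C. F x) = (\<Inter>F\<in>C. F x)"
      using F by blast
    finally show "compact (\<Inter>F\<in>C. F x)" .
  qed
qed

lemma usco_contains_minimal_usco:
  fixes \<Phi> :: "'a::topological_space \<Rightarrow> 'b::t2_space set"
  assumes "usco \<Phi>"
  obtains F where "minimal_usco F" "F \<le> \<Phi>"
proof -
  define A where "A = {F. usco F \<and> F \<le> \<Phi>}"
  have "\<exists>F\<in>A. \<forall>G\<in>A. G \<le> F \<longrightarrow> G = F"
  \<comment> \<open>The order is reversed, so lower bounds of chains yield a minimal element; the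
    empty chain is bounded by \<open>\<Phi>\<close>.\<close>
  proof (rule predicate_Zorn)
    show "partial_order_on A (relation_of (\<lambda>F G. G \<le> F) A)"
      by (rule partial_order_on_relation_ofI) auto
    fix C assume C: "C \<in> Chains (relation_of (\<lambda>F G. G \<le> F) A)"
    then have CA: "C \<subseteq> A"
      by (rule Chains_relation_of)
    show "\<exists>L\<in>A. \<forall>F\<in>C. L \<le> F"
    proof (cases "C = {}")
      case True
      then show ?thesis
        using assms by (auto simp: A_def)
    next
      case False
      have "usco (\<lambda>x. \<Inter>F\<in>C. F x)"
        using C CA by (intro usco_INF_chain False) (auto simp: Chains_def relation_of_def A_def)
      moreover have lower: "(\<lambda>x. \<Inter>F\<in>C. F x) \<le> F" if "F \<in> C" for F
        using that by (auto simp: le_fun_def)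
      moreover obtain F where "F \<in> C"
        using False by blast
      then have "(\<lambda>x. \<Inter>F\<in>C. F x) \<le> \<Phi>"
        using lower CA by (auto simp: A_def intro: order_trans)
      ultimately show ?thesis
        by (intro bexI[of _ "\<lambda>x. \<Inter>F\<in>C. F x"]) (auto simp: A_def)
    qed
  qed
  then obtain F where F: "usco F" "F \<le> \<Phi>" "\<And>G. usco G \<Longrightarrow> G \<le> \<Phi> \<Longrightarrow> G \<le> F \<Longrightarrow> G = F"
    by (auto simp: A_def)
  have "minimal_usco F"
    unfolding minimal_usco_def
  proof (intro conjI allI impI)
    fix G assume G: "usco G \<and> (\<forall>x. G x \<subseteq> F x)"
    then have "G \<le> F"
      by (simp add: le_fun_def)
    then show "G = F"
      using G F(2,3) by (meson order_trans)
  qed (rule F(1))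
  then show thesis
    using F(2) by (rule that)
qed

section \<open>Closed convex hulls of usco maps\<close>

lemma cusco_co_map:
  fixes F :: "'a::topological_space \<Rightarrow> 'b::banach set"
  assumes "usco F"
  shows "cusco (co_map F)"
  unfolding cusco_def usco_def usc_def
proof (intro conjI allI impI)
  fix x V assume V: "open V \<and> co_map F x \<subseteq> V"
  have ne: "co_map F x \<noteq> {}" and com: "compact (co_map F x)"
    using assms by (auto simp: usco_def co_map_def compact_closure_convex_hull)
  obtain e where e: "e > 0" "{y. infdist y (co_map F x) < e} \<subseteq> V"
    using V ne com by (metis compact_subset_open_infdist)
  have "F x \<subseteq> co_map F x"
    by (simp add: co_map_def subset_closure_convex_hull)
  \<comment> \<open>Halving \<open>e\<close> leaves room for the non-strict bound
    \<open>e / 2\<close>, which defines a closed convex set and so passes from \<open>F u\<close> to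
    \<open>co_map F u\<close>.\<close>
  also have "\<dots> \<subseteq> {y. infdist y (co_map F x) < e / 2}"
    using e(1) by auto
  finally have sub: "F x \<subseteq> {y. infdist y (co_map F x) < e / 2}" .
  have "usc F"
    using assms by (simp add: usco_def)
  obtain U where U: "open U" "x \<in> U" "\<And>u. u \<in> U \<Longrightarrow> F u \<subseteq> {y. infdist y (co_map F x) < e / 2}"
    using uscD[OF \<open>usc F\<close> open_infdist_less sub] by blast
  have "co_map F u \<subseteq> V" if "u \<in> U" for u
  proof -
    have "F u \<subseteq> {y. infdist y (co_map F x) \<le> e / 2}"
      using U(3)[OF that] by (rule order_trans) auto
    then have "co_map F u \<subseteq> {y. infdist y (co_map F x) \<le> e / 2}"
      unfolding co_map_def
      by (intro closure_convex_hull_minimal convex_infdist_le closed_infdist_le) auto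
    also have "\<dots> \<subseteq> {y. infdist y (co_map F x) < e}"
      using e(1) by auto
    finally show ?thesis
      using e(2) by blast
  qed
  then show "\<exists>U. open U \<and> x \<in> U \<and> (\<forall>u\<in>U. co_map F u \<subseteq> V)"
    using U by blast
qed (use assms in \<open>auto simp: usco_def co_map_def compact_closure_convex_hull\<close>)

text \<open>It suffices that a cusco map \<open>G\<close> below \<open>co_map F\<close> contains
  \<open>F\<close>. If \<open>y\<close> in \<open>F x\<close> were at distance
  \<open>2 * e > 0\<close> from \<open>G x\<close>, then for some \<open>u\<close> near
  \<open>x\<close> the set \<open>G u\<close> would lie both within \<open>e\<close> of
  \<open>G x\<close> (strictly) and in \<open>cball y e\<close>, which is impossible.\<close>

lemma minimal_cusco_co_map:
  fixes F :: "'a::topological_space \<Rightarrow> 'b::banach set"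
  assumes F: "minimal_usco F"
  shows "minimal_cusco (co_map F)"
  unfolding minimal_cusco_def
proof (intro conjI allI impI)
  show "cusco (co_map F)"
    using F by (simp add: cusco_co_map minimal_usco_def)
  fix G assume G: "cusco G \<and> (\<forall>x. G x \<subseteq> co_map F x)"
  then have usc: "usc G" and Gx: "\<And>x. G x \<noteq> {} \<and> compact (G x) \<and> convex (G x)"
    by (auto simp: cusco_def usco_def)
  have "F x \<subseteq> G x" for x
  proof (rule ccontr)
    assume "\<not> F x \<subseteq> G x"
    then obtain y where y: "y \<in> F x" "y \<notin> G x"
      by blast
    define e where "e = infdist y (G x) / 2"
    have e: "e > 0"
      using y(2) Gx infdist_pos_not_in_closed[of "G x" y] by (auto simp: e_def compact_imp_closed)
    have sub: "G x \<subseteq> {z. infdist z (G x) < e}"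
      using e by auto
    obtain U where U: "open U" "x \<in> U" "\<And>u. u \<in> U \<Longrightarrow> G u \<subseteq> {z. infdist z (G x) < e}"
      using uscD[OF usc open_infdist_less sub] by blast
    obtain u where u: "u \<in> U" "F u \<subseteq> ball y e"
      using minimal_usco_meets_open[OF F U(1,2), of "ball y e"] y(1) e by force
    have "co_map F u \<subseteq> cball y e"
      unfolding co_map_def using u(2) ball_subset_cball
      by (intro closure_convex_hull_minimal) auto
    moreover obtain z where z: "z \<in> G u"
      using Gx by blast
    ultimately have "dist y z \<le> e"
      using G by force
    moreover have "infdist z (G x) < e"
      using U(3) u(1) z by blast
    ultimately show False
      using infdist_triangle[of y "G x" z] by (simp add: e_def)
  qed
  then have "co_map F x \<subseteq> G x" for x
    unfolding co_map_def using Gx by (intro closure_convex_hull_minimal) (auto simp: compact_imp_closed)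
  then show "G = co_map F"
    using G by (auto simp: fun_eq_iff)
qed

lemma co_map_image_MU:
  "co_map ` (MU :: ('a::topological_space \<Rightarrow> 'b::banach set) set) = MC"
proof
  show "co_map ` (MU :: ('a \<Rightarrow> 'b set) set) \<subseteq> MC"
    by (auto simp: MU_def MC_def minimal_cusco_co_map)
  show "MC \<subseteq> co_map ` (MU :: ('a \<Rightarrow> 'b set) set)"
  proof
    fix \<Phi> :: "'a \<Rightarrow> 'b set" assume "\<Phi> \<in> MC"
    then have \<Phi>: "minimal_cusco \<Phi>"
      by (simp add: MC_def)
    then have "usco \<Phi>" and conv: "\<And>x. convex (\<Phi> x) \<and> closed (\<Phi> x)"
      by (auto simp: minimal_cusco_def cusco_def usco_def compact_imp_closed)
    then obtain F where F: "minimal_usco F" "F \<le> \<Phi>"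
      by (metis usco_contains_minimal_usco)
    have "co_map F x \<subseteq> \<Phi> x" for x
      unfolding co_map_def using F(2) conv
      by (intro closure_convex_hull_minimal) (auto simp: le_fun_def)
    moreover have "cusco (co_map F)"
      using F(1) by (simp add: cusco_co_map minimal_usco_def)
    \<comment> \<open>The hull of the minimal usco map is a cusco map below \<open>\<Phi>\<close>,
      so minimality of \<open>\<Phi>\<close> forces equality.\<close>
    ultimately have "co_map F = \<Phi>"
      using \<Phi> by (simp add: minimal_cusco_def)
    then show "\<Phi> \<in> co_map ` MU"
      using F(1) by (auto simp: MU_def)
  qed
qed

text \<open>Near any \<open>x\<close> there is a \<open>u\<close> for which \<open>F u\<close>, hence also its closed convex hull, lies in a small
  ball around a prescribed point of \<open>F x\<close>; there, passing to convex hulls loses nothing.\<close>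

lemma excess_le_excess_co_map:
  fixes F G :: "'a::topological_space \<Rightarrow> 'b::real_normed_vector set"
  assumes F: "minimal_usco F" and G: "usco G" and "open U" "x \<in> U"
    and le: "\<And>u. u \<in> U \<Longrightarrow> excess (co_map G u) (co_map F u) \<le> ereal r"
  shows "excess (F x) (G x) \<le> ereal r"
  unfolding excess_le_iff
proof
  fix y assume y: "y \<in> F x"
  show "infdist y (G x) \<le> r"
  proof (rule field_le_epsilon)
    fix e :: real assume "e > 0"
    have "usc G"
      using G by (simp add: usco_def)
    have sub: "G x \<subseteq> {z. infdist z (G x) < e / 2}"
      using \<open>e > 0\<close> by auto
    obtain N where N: "open N" "x \<in> N" "\<And>u. u \<in> N \<Longrightarrow> G u \<subseteq> {z. infdist z (G x) < e / 2}"
      using uscD[OF \<open>usc G\<close> open_infdist_less sub] by blast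
    have "open (N \<inter> U)" "x \<in> N \<inter> U" "F x \<inter> ball y (e / 2) \<noteq> {}"
      using N(1,2) assms(3,4) y \<open>e > 0\<close> by auto
    then obtain u where u: "u \<in> N \<inter> U" "F u \<subseteq> ball y (e / 2)"
      using minimal_usco_meets_open[OF F] open_ball by metis
    have ball: "co_map F u \<subseteq> cball y (e / 2)"
      unfolding co_map_def using u(2) ball_subset_cball
      by (intro closure_convex_hull_minimal) auto
    have ne: "F u \<noteq> {}" "G u \<noteq> {}"
      using F G by (auto simp: minimal_usco_def usco_def)
    then obtain z where z: "z \<in> G u"
      by blast
    \<comment> \<open>The hypothesis bounds the excess in the opposite direction. As all of
      \<open>co_map F u\<close> is within \<open>e / 2\<close> of \<open>y\<close>, closeness of
      \<open>z\<close> to that set means closeness to \<open>y\<close>, and \<open>z\<close> is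
      close to \<open>G x\<close>.\<close>
    have "dist y z - e / 2 \<le> infdist z (co_map F u)"
    proof (rule le_infdistI)
      show "co_map F u \<noteq> {}"
        using ne by (simp add: co_map_def)
      fix c assume "c \<in> co_map F u"
      then have "dist y c \<le> e / 2"
        using ball by auto
      then show "dist y z - e / 2 \<le> dist z c"
        using dist_triangle2[of y z c] by simp
    qed
    also have "z \<in> co_map G u"
      using z subset_closure_convex_hull by (auto simp: co_map_def)
    then have "infdist z (co_map F u) \<le> r"
      using le u(1) by (auto simp: excess_le_iff)
    finally have "dist y z \<le> r + e / 2"
      by simp
    moreover have "infdist z (G x) < e / 2"
      using N(3) u(1) z by blast
    ultimately show "infdist y (G x) \<le> r + e"
      using infdist_triangle[of y "G x" z] by simp
  qed
qed

lemma Hausdorff_dist_le_Hausdorff_dist_co_map: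
  fixes F G :: "'a::topological_space \<Rightarrow> 'b::real_normed_vector set"
  assumes "minimal_usco F" "minimal_usco G" "open U" "x \<in> U"
    and "\<And>u. u \<in> U \<Longrightarrow> Hausdorff_dist (co_map F u) (co_map G u) \<le> ereal r"
  shows "Hausdorff_dist (F x) (G x) \<le> ereal r"
proof -
  have "usco F" "usco G"
    using assms(1,2) by (simp_all add: minimal_usco_def)
  moreover have "excess (co_map F u) (co_map G u) \<le> ereal r"
    "excess (co_map G u) (co_map F u) \<le> ereal r" if "u \<in> U" for u
    using assms(5)[OF that] by (simp_all add: Hausdorff_dist_le_iff)
  ultimately show ?thesis
    unfolding Hausdorff_dist_le_iff
    using assms(1-4) by (blast intro: excess_le_excess_co_map)
qed

section \<open>Injectivity of the closed convex hull map\<close>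

lemma Hausdorff_dist_le_0_imp_eq:
  assumes "Hausdorff_dist A B \<le> 0" "closed A" "closed B" "A \<noteq> {}" "B \<noteq> {}"
  shows "A = B"
proof -
  have "infdist a B = 0" if "a \<in> A" for a
    using assms(1) that excess_le_iff[of A B 0] infdist_nonneg[of a B]
    by (auto simp: Hausdorff_dist_le_iff zero_ereal_def intro: antisym)
  moreover have "infdist b A = 0" if "b \<in> B" for b
    using assms(1) that excess_le_iff[of B A 0] infdist_nonneg[of b A]
    by (auto simp: Hausdorff_dist_le_iff zero_ereal_def intro: antisym)
  ultimately show ?thesis
    using assms in_closed_iff_infdist_zero by blast
qed

lemma MU_subset_closed_maps: "(MU :: ('a::topological_space \<Rightarrow> 'b::t2_space set) set) \<subseteq> closed_maps"
  by (auto simp: MU_def minimal_usco_def usco_def closed_maps_def compact_imp_closed)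

lemma MC_subset_closed_maps: "MC \<subseteq> closed_maps"
  by (auto simp: MC_def minimal_cusco_def cusco_def usco_def closed_maps_def compact_imp_closed)

lemma inj_on_co_map_MU:
  "inj_on co_map (MU :: ('a::topological_space \<Rightarrow> 'b::real_normed_vector set) set)"
proof (rule inj_onI)
  fix F G :: "'a \<Rightarrow> 'b set"
  assume F: "F \<in> MU" and G: "G \<in> MU" and eq: "co_map F = co_map G"
  have "Hausdorff_dist (F x) (G x) \<le> ereal 0" for x
    using F G eq Hausdorff_dist_self
    \<comment> \<open>Equal hulls are at distance 0 on the whole space, so the transfer estimate
      applies with \<open>r = 0\<close>.\<close>
    by (intro Hausdorff_dist_le_Hausdorff_dist_co_map[of F G UNIV]) (auto simp: MU_def zero_ereal_def)
  moreover have "F \<in> closed_maps" "G \<in> closed_maps"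
    using F G MU_subset_closed_maps by blast+
  ultimately show "F = G"
    by (intro ext Hausdorff_dist_le_0_imp_eq) (auto simp: closed_maps_def zero_ereal_def)
qed

section \<open>The topology of uniform convergence on compact sets\<close>

lemma UC_entourage_triangle:
  assumes "(\<Phi>, \<Psi>) \<in> UC_entourage K (e / 3)" "(\<Psi>, \<Omega>) \<in> UC_entourage K (e / 3)" "e > 0"
  shows "(\<Phi>, \<Omega>) \<in> UC_entourage K e"
proof -
  have "Hausdorff_dist (\<Phi> x) (\<Omega> x) < ereal e" if "x \<in> K" for x
  proof -
    \<comment> \<open>The triangle inequality is available for non-strict bounds; thirds rather than
      halves make the final bound strict.\<close>
    have "Hausdorff_dist (\<Phi> x) (\<Omega> x) \<le> ereal (e / 3 + e / 3)"
      using assms that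
      by (intro Hausdorff_dist_triangle[of _ "\<Psi> x"]) (auto simp: UC_entourage_def closed_maps_def intro: less_imp_le)
    also have "\<dots> < ereal e"
      using \<open>e > 0\<close> by simp
    finally show ?thesis .
  qed
  then show ?thesis
    using assms by (auto simp: UC_entourage_def)
qed

lemma UC_entourage_refl:
  assumes "\<Phi> \<in> closed_maps" "e > 0"
  shows "(\<Phi>, \<Phi>) \<in> UC_entourage K e"
  using assms by (auto simp: UC_entourage_def intro: le_less_trans[OF Hausdorff_dist_self])

text \<open>This reduces continuity and openness of \<open>co_map\<close> to inclusions between
  sections of entourages within \<open>MU\<close> and \<open>MC\<close>.\<close>

lemma openin_subtopology_UC:
  assumes "S \<subseteq> closed_maps"
  shows "openin (subtopology UC_topology S) W \<longleftrightarrow> W \<subseteq> S \<and>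
    (\<forall>\<Phi>\<in>W. \<exists>K e. compact K \<and> K \<noteq> {} \<and> e > 0 \<and> UC_entourage K e `` {\<Phi>} \<inter> S \<subseteq> W)"
    (is "_ \<longleftrightarrow> _ \<and> (\<forall>\<Phi>\<in>W. ?P \<Phi>)")
proof (intro iffI conjI ballI)
  assume "openin (subtopology UC_topology S) W"
  then obtain T where T: "UC_open T" "W = T \<inter> S"
    by (auto simp: openin_subtopology openin_UC_topology)
  then show "W \<subseteq> S"
    by blast
  fix \<Phi> assume "\<Phi> \<in> W"
  then obtain K e where "compact K" "K \<noteq> {}" "e > 0" "UC_entourage K e `` {\<Phi>} \<subseteq> T"
    using T unfolding UC_open_def by (metis IntD1)
  then show "?P \<Phi>"
    using T(2) by blast
next
  assume W: "W \<subseteq> S \<and> (\<forall>\<Phi>\<in>W. ?P \<Phi>)"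
  \<comment> \<open>An open set with trace \<open>W\<close> on \<open>S\<close>: the triangle
    property makes \<open>T\<close> open, and reflexivity of entourages puts
    \<open>T \<inter> S\<close> inside \<open>W\<close>.\<close>
  define T where "T = {\<Phi> \<in> closed_maps. ?P \<Phi>}"
  have "UC_open T"
    unfolding UC_open_def
  proof (intro conjI ballI)
    show "T \<subseteq> closed_maps"
      by (auto simp: T_def)
    fix \<Phi> assume "\<Phi> \<in> T"
    then obtain K e where K: "compact K" "K \<noteq> {}" and e: "e > 0"
      and sub: "UC_entourage K e `` {\<Phi>} \<inter> S \<subseteq> W"
      by (auto simp: T_def)
    have "UC_entourage K (e / 3) `` {\<Phi>} \<subseteq> T"
    proof
      fix \<Psi> assume "\<Psi> \<in> UC_entourage K (e / 3) `` {\<Phi>}"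
      then have \<Psi>: "(\<Phi>, \<Psi>) \<in> UC_entourage K (e / 3)"
        by simp
      then have "UC_entourage K (e / 3) `` {\<Psi>} \<inter> S \<subseteq> W"
        using sub e UC_entourage_triangle by blast
      moreover have "\<Psi> \<in> closed_maps"
        using \<Psi> by (simp add: UC_entourage_def)
      ultimately show "\<Psi> \<in> T"
        unfolding T_def using K e
        by (auto intro!: exI[of _ K] exI[of _ "e / 3"])
    qed
    then show "\<exists>K e. compact K \<and> K \<noteq> {} \<and> e > 0 \<and> UC_entourage K e `` {\<Phi>} \<subseteq> T"
      using K e by (intro exI[of _ K] exI[of _ "e / 3"]) auto
  qed
  moreover have "W = T \<inter> S"
  proof
    show "W \<subseteq> T \<inter> S"
      using W assms by (auto simp: T_def)
    show "T \<inter> S \<subseteq> W"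
    proof
      fix \<Phi> assume \<Phi>: "\<Phi> \<in> T \<inter> S"
      then obtain K e where "e > 0" "UC_entourage K e `` {\<Phi>} \<inter> S \<subseteq> W"
        by (auto simp: T_def)
      then show "\<Phi> \<in> W"
        using \<Phi> assms UC_entourage_refl by blast
    qed
  qed
  ultimately show "openin (subtopology UC_topology S) W"
    by (auto simp: openin_subtopology openin_UC_topology)
qed

lemma co_map_UC_entourage:
  assumes "(F, G) \<in> UC_entourage K (e / 2)" "e > 0" "co_map F \<in> closed_maps" "co_map G \<in> closed_maps"
  shows "(co_map F, co_map G) \<in> UC_entourage K e"
proof -
  have "Hausdorff_dist (co_map F x) (co_map G x) < ereal e" if "x \<in> K" for x
  proof -
    have "Hausdorff_dist (co_map F x) (co_map G x) \<le> ereal (e / 2)"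
      using assms(1) that
      by (intro Hausdorff_dist_co_map_le) (auto simp: UC_entourage_def closed_maps_def intro: less_imp_le)
    also have "\<dots> < ereal e"
      using \<open>e > 0\<close> by simp
    finally show ?thesis .
  qed
  then show ?thesis
    using assms by (auto simp: UC_entourage_def)
qed

text \<open>Recovering \<open>F\<close> and \<open>G\<close> at a point of \<open>K\<close> requires
  control of their hulls on a neighbourhood of that point. Hence \<open>K\<close> is enlarged to
  \<open>L\<close> through an open set \<open>U\<close>.\<close>

lemma UC_entourage_co_mapD:
  fixes F G :: "'a::topological_space \<Rightarrow> 'b::real_normed_vector set"
  assumes "(co_map F, co_map G) \<in> UC_entourage L (e / 2)" "e > 0" "F \<in> MU" "G \<in> MU"
    and "open U" "K \<subseteq> U" "U \<subseteq> L"
  shows "(F, G) \<in> UC_entourage K e"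
proof -
  have "Hausdorff_dist (F x) (G x) < ereal e" if "x \<in> K" for x
  proof -
    have "Hausdorff_dist (F x) (G x) \<le> ereal (e / 2)"
      using assms that
      by (intro Hausdorff_dist_le_Hausdorff_dist_co_map[of F G U])
        (auto simp: UC_entourage_def MU_def intro: less_imp_le)
    also have "\<dots> < ereal e"
      using \<open>e > 0\<close> by simp
    finally show ?thesis .
  qed
  then show ?thesis
    using assms MU_subset_closed_maps by (auto simp: UC_entourage_def)
qed

section \<open>Continuity and openness of the closed convex hull map\<close>

lemma continuous_map_co_map:
  "continuous_map (subtopology UC_topology MU)
     (subtopology UC_topology (MC :: ('a::topological_space \<Rightarrow> 'b::banach set) set)) co_map"
  unfolding continuous_map
proof (intro conjI allI impI)
  have top: "topspace (subtopology UC_topology (MU :: ('a \<Rightarrow> 'b set) set)) = MU"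
    "topspace (subtopology UC_topology (MC :: ('a \<Rightarrow> 'b set) set)) = MC"
    using MU_subset_closed_maps MC_subset_closed_maps by (auto simp: topspace_UC_topology)
  show "co_map ` topspace (subtopology UC_topology (MU :: ('a \<Rightarrow> 'b set) set))
      \<subseteq> topspace (subtopology UC_topology MC)"
    unfolding top co_map_image_MU by (rule order_refl)
  fix W :: "('a \<Rightarrow> 'b set) set"
  assume W: "openin (subtopology UC_topology MC) W"
  show "openin (subtopology UC_topology MU) {F \<in> topspace (subtopology UC_topology MU). co_map F \<in> W}"
    unfolding openin_subtopology_UC[OF MU_subset_closed_maps] top
  proof (intro conjI ballI)
    fix F assume F: "F \<in> {F \<in> MU. co_map F \<in> W}"
    then obtain K e where K: "compact K" "K \<noteq> {}" and e: "e > 0"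
      and sub: "UC_entourage K e `` {co_map F} \<inter> MC \<subseteq> W"
      using W unfolding openin_subtopology_UC[OF MC_subset_closed_maps] by blast
    \<comment> \<open>Taking hulls is a pointwise contraction, so the same compact set
      \<open>K\<close> serves; halving \<open>e\<close> only restores strictness.\<close>
    have "UC_entourage K (e / 2) `` {F} \<inter> MU \<subseteq> {F \<in> MU. co_map F \<in> W}"
    proof clarify
      fix G assume G: "(F, G) \<in> UC_entourage K (e / 2)" "G \<in> MU"
      have "co_map F \<in> MC" "co_map G \<in> MC"
        using F G(2) co_map_image_MU by blast+
      then show "co_map G \<in> W"
        using co_map_UC_entourage[OF G(1) e] sub MC_subset_closed_maps by blast
    qed
    then show "\<exists>K e. compact K \<and> K \<noteq> {} \<and> e > 0 \<and>
        UC_entourage K e `` {F} \<inter> MU \<subseteq> {F \<in> MU. co_map F \<in> W}"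
      using K e by (intro exI[of _ K] exI[of _ "e / 2"]) auto
  qed blast
qed

lemma open_map_co_map:
  assumes "locally_compact_space (euclidean :: 'a::t2_space topology)"
  shows "open_map (subtopology UC_topology MU)
    (subtopology UC_topology (MC :: ('a \<Rightarrow> 'b::banach set) set)) co_map"
  unfolding open_map_def
proof (intro allI impI)
  fix W :: "('a \<Rightarrow> 'b set) set"
  assume W: "openin (subtopology UC_topology MU) W"
  then have "W \<subseteq> MU"
    unfolding openin_subtopology_UC[OF MU_subset_closed_maps] by blast
  show "openin (subtopology UC_topology MC) (co_map ` W)"
    unfolding openin_subtopology_UC[OF MC_subset_closed_maps]
  proof (intro conjI ballI)
    show "co_map ` W \<subseteq> MC"
      using \<open>W \<subseteq> MU\<close> co_map_image_MU by blast
    fix \<Phi> assume "\<Phi> \<in> co_map ` W"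
    then obtain F where F: "F \<in> W" "\<Phi> = co_map F"
      by blast
    then obtain K e where K: "compact K" "K \<noteq> {}" and e: "e > 0"
      and sub: "UC_entourage K e `` {F} \<inter> MU \<subseteq> W"
      using W unfolding openin_subtopology_UC[OF MU_subset_closed_maps] by blast
    have "Hausdorff_space (euclidean :: 'a topology)"
      using hausdorff by (auto simp: Hausdorff_space_def disjnt_def)
    \<comment> \<open>Local compactness enters here: it supplies the compact neighbourhood on which
      the hulls must be compared.\<close>
    then obtain U L where UL: "open U" "compact L" "K \<subseteq> U" "U \<subseteq> L"
      using assms K(1) by (auto simp: locally_compact_space_compact_closed_compact)
    have "UC_entourage L (e / 2) `` {\<Phi>} \<inter> MC \<subseteq> co_map ` W"
    proof clarify
      fix \<Psi> assume \<Psi>: "(\<Phi>, \<Psi>) \<in> UC_entourage L (e / 2)" "\<Psi> \<in> MC"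
      then obtain G where G: "G \<in> MU" "\<Psi> = co_map G"
        using co_map_image_MU by blast
      have "(F, G) \<in> UC_entourage K e"
        using \<Psi>(1) F G e \<open>W \<subseteq> MU\<close> UL by (auto intro: UC_entourage_co_mapD)
      then show "\<Psi> \<in> co_map ` W"
        using sub G by blast
    qed
    then show "\<exists>K e. compact K \<and> K \<noteq> {} \<and> e > 0 \<and> UC_entourage K e `` {\<Phi>} \<inter> MC \<subseteq> co_map ` W"
      using UL K(2) e by (intro exI[of _ L] exI[of _ "e / 2"]) auto
  qed
qed

theorem theorem3p2:
  assumes "locally_compact_space (euclidean :: 'a::t2_space topology)"
  shows "homeomorphic_map
           (subtopology UC_topology (MU :: ('a \<Rightarrow> 'b::banach set) set))
           (subtopology UC_topology (MC :: ('a \<Rightarrow> 'b set) set))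
           co_map"
proof (rule bijective_open_imp_homeomorphic_map)
  have "topspace (subtopology UC_topology (MU :: ('a \<Rightarrow> 'b set) set)) = MU"
    "topspace (subtopology UC_topology (MC :: ('a \<Rightarrow> 'b set) set)) = MC"
    using MU_subset_closed_maps MC_subset_closed_maps by (auto simp: topspace_UC_topology)
  then show "co_map ` topspace (subtopology UC_topology (MU :: ('a \<Rightarrow> 'b set) set))
      = topspace (subtopology UC_topology MC)"
    and "inj_on co_map (topspace (subtopology UC_topology (MU :: ('a \<Rightarrow> 'b set) set)))"
    by (simp_all add: co_map_image_MU inj_on_co_map_MU)
qed (use assms in \<open>auto intro: continuous_map_co_map open_map_co_map\<close>)

end
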